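(* Let $s,t$ be non-negative integers, let $\Delta=\mathrm{conv}(\mathbf{e}_1,\ldots,\mathbf{e}_{s+1})\subset\mathbb{R}^{s+1}$ be the $s$-dimensional simplex, where the $\mathbf{e}_j$ are the standard basis vectors of $\mathbb{R}^{s+1}$, and let $M=\Delta\times\mathbb{R}^t$. For $j=1,\ldots,s+1$ let $F_j=\mathrm{conv}(\mathbf{e}_i : i\ne j)$ be the face of $\Delta$ opposite to $\mathbf{e}_j$, and let $M_j=F_j\times\mathbb{R}^t\subset M$. Suppose that $\mathcal{U}$ is a cover of $M$ by open sets satisfying the following conditions: (i) For any connected component $U$ of any element of $\mathcal{U}$ there exists $j\in\{1,\ldots,s+1\}$ such that $U\cap M_j=\varnothing$. (ii) There is $R>0$ such that for every positive integer $k\le s+t$ and any connected component $U$ of the intersection of $k$ distinct elements of $\mathcal{U}$, the projection of $U$ to $\mathbb{R}^t$ is $(R,s+t-k)$-almost affine. Then there is a point of $M$ which is covered at least $s+t+1$ times, i.e. which belongs to at least $s+t+1$ distinct elements of $\mathcal{U}$.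
   Context: Given $R>0$ and an integer $k\geq 0$, a subset $U\subset\mathbb{R}^t$ is called $(R,k)$-almost affine if it is contained in an $R$-neighborhood of a $k$-dimensional affine subspace of $\mathbb{R}^t$; when $k\ge t$, every subset of $\mathbb{R}^t$ is regarded as $(R,k)$-almost affine (so that condition (ii) is vacuous for $k\le s$). "Open" means open in $M$ with its natural topology. The convex hull of the empty set is empty (so for $s=0$ one has $F_1=M_1=\varnothing$). *)

theory Defs
  imports "HOL-Analysis.Analysis"
begin

text \<open>
  A type \<open>real ^ 'm\<close> always has dimension at least 1, so \<open>\<real>\<^sup>t\<close> with \<open>t = 0\<close> allowed is
  rendered as a linear subspace \<open>V\<close> of dimension \<open>t\<close> of a Euclidean space, with the induced
  metric and topology. Taking \<open>V = UNIV\<close> in \<open>real ^ 'm\<close> gives \<open>\<real>\<^sup>t\<close> itself for \<open>t = CARD('m)\<close>,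
  and \<open>V = {0}\<close> gives \<open>t = 0\<close>. For \<open>\<real>\<^sup>s\<^sup>+\<^sup>1\<close> the type \<open>real ^ 'n\<close> with \<open>CARD('n) = s + 1\<close> suffices.
\<close>

definition std_simplex :: "(real ^ 'n) set" where
  "std_simplex = convex hull (range (\<lambda>i. axis i 1))"

definition opp_face :: "'n \<Rightarrow> (real ^ 'n) set" where
  "opp_face j = convex hull {axis i 1 |i. i \<noteq> j}"

text \<open>
  The affine subspace is required to lie inside \<open>V\<close>. The disjunct \<open>dim V \<le> k\<close> is the convention
  that every subset of \<open>V\<close> is \<open>(R, k)\<close>-almost affine for \<open>k \<ge> dim V\<close>.
\<close>

definition almost_affine :: "'a::euclidean_space set \<Rightarrow> real \<Rightarrow> nat \<Rightarrow> 'a set \<Rightarrow> bool" where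
  "almost_affine V R k S \<longleftrightarrow>
     S \<subseteq> V \<and>
     (dim V \<le> k \<or>
      (\<exists>A. affine A \<and> A \<subseteq> V \<and> aff_dim A = int k \<and> S \<subseteq> (\<Union>a\<in>A. ball a R)))"

end

theory Submission
  imports Defs
begin

text \<open>
  Suppose every point lies in at most \<open>n = s + t\<close> elements. Comparing the distances to the
  complements of the elements, as in the barycentric subdivision of the nerve, gives \<open>n\<close> families
  \<open>\<G> 1, \<dots>, \<G> n\<close> of pairwise disjoint connected open sets that together cover \<open>M\<close>, each member of
  \<open>\<G> k\<close> lying in a component of an intersection of \<open>k\<close> elements. Give each member the colour of
  a face it misses; a point carrying all \<open>s + 1\<close> colours lies in some \<open>\<G> k\<close> with \<open>k > s\<close>, since
  each family contributes at most one colour.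

  On the union \<open>H\<close> of these \<open>\<G> k\<close> one builds, starting from \<open>k = n\<close>, a map to \<open>V\<close> at bounded distance
  from the projection whose image is a countable union of smooth pieces of dimension \<open>< t\<close>: over a
  member of \<open>\<G> k\<close> the map takes values in the nearby affine subspace of dimension \<open>n - k\<close>, and in the
  mapping cylinder joining the earlier values to that subspace. By Brouwer's theorem, a
  map at bounded distance from the projection takes every value of \<open>V\<close> on the set of points
  carrying all colours, whereas the image of \<open>H\<close> is null in \<open>V\<close>.
\<close>

subsection \<open>Small sets\<close>

lemma subspace_orthogonal_projection:
  fixes S :: "'a::euclidean_space set"
  assumes "subspace S"
  obtains p where "linear p" "\<And>x. p x \<in> S" "\<And>x y. y \<in> S \<Longrightarrow> (x - p x) \<bullet> y = 0"
proof -
  obtain B where B: "B \<subseteq> S" "pairwise orthogonal B" "\<And>x. x \<in> B \<Longrightarrow> norm x = 1"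
      "independent B" "span B = S"
    using orthonormal_basis_subspace [OF assms] by metis
  have "finite B" using B(4) independent_imp_finite by blast
  define p where "p x = (\<Sum>b\<in>B. (x \<bullet> b) *\<^sub>R b)" for x
  show ?thesis
  proof
    show "linear p"
      by (auto simp: p_def linear_iff inner_add_left scaleR_add_left sum.distrib scaleR_sum_right)
    show "p x \<in> S" for x
      unfolding p_def using B(1) assms by (intro subspace_sum subspace_scale) auto
    have 1: "(x - p x) \<bullet> b = 0" if "b \<in> B" for x b
    proof -
      have "p x \<bullet> b = (\<Sum>c\<in>B. if c = b then x \<bullet> b else 0)"
        unfolding p_def inner_sum_left
        using B(2,3) that by (intro sum.cong) (auto simp: pairwise_def orthogonal_def norm_eq_1)
      then show ?thesis
        using \<open>finite B\<close> that by (simp add: inner_diff_left)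
    qed
    show "(x - p x) \<bullet> y = 0" if "y \<in> S" for x y
      using that unfolding B(5)[symmetric]
      by (induction rule: span_induct) (auto simp: 1 subspace_hyperplane)
  qed
qed

text \<open>With a point of \<open>A\<close> moved to the origin, \<open>x - a\<close> splits into a
  normal and a tangential part, and Pythagoras gives minimality. Minimality will bound
  displacements; differentiability is what \<open>lowdim_cylinder\<close> asks of
  \<open>p\<close>.\<close>

lemma affine_orthogonal_projection:
  fixes A :: "'a::euclidean_space set"
  assumes "affine A" "A \<noteq> {}"
  obtains p where "p differentiable_on UNIV" "\<And>x. p x \<in> A" "\<And>x a. a \<in> A \<Longrightarrow> norm (p x - x) \<le> norm (x - a)"
proof -
  obtain c where c: "c \<in> A" using assms by blast
  define S where "S = (\<lambda>x. x - c) ` A"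
  have S: "subspace S"
    unfolding S_def by (rule affine_diffs_subspace_subtract [OF assms(1) c])
  obtain q where q: "linear q" "\<And>x. q x \<in> S" "\<And>x y. y \<in> S \<Longrightarrow> (x - q x) \<bullet> y = 0"
    using subspace_orthogonal_projection [OF S] by blast
  show ?thesis
  proof
    have "q differentiable_on UNIV"
      using q(1) linear_imp_differentiable_on by blast
    moreover have "(\<lambda>x. x - c) differentiable_on UNIV"
      by (simp add: differentiable_on_diff)
    ultimately have "(\<lambda>x. q (x - c)) differentiable_on UNIV"
      using differentiable_on_compose[of "\<lambda>x. x - c" UNIV q] differentiable_on_subset by blast
    then show "(\<lambda>x. c + q (x - c)) differentiable_on UNIV"
      by (intro differentiable_on_add differentiable_on_const)
    show "c + q (x - c) \<in> A" for x
      using q(2)[of "x - c"] by (auto simp: S_def)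
    show "norm (c + q (x - c) - x) \<le> norm (x - a)" if "a \<in> A" for x a
    proof -
      let ?u = "(x - c) - q (x - c)" and ?v = "q (x - c) - (a - c)"
      have "?v \<in> S"
        using S q(2) by (rule subspace_diff) (use that in \<open>simp add: S_def\<close>)
      then have "orthogonal ?u ?v"
        using q(3) by (simp add: orthogonal_def)
      then have "(norm (?u + ?v))\<^sup>2 = (norm ?u)\<^sup>2 + (norm ?v)\<^sup>2"
        by (rule norm_add_Pythagorean)
      then have "(norm ?u)\<^sup>2 \<le> (norm (?u + ?v))\<^sup>2" by simp
      then have "norm ?u \<le> norm (?u + ?v)"
        using norm_ge_zero power2_le_imp_le by blast
      moreover have "norm (c + q (x - c) - x) = norm ?u"
        by (metis (no_types, lifting) add_diff_eq diff_diff_add diff_diff_eq2 norm_minus_commute)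
      ultimately show ?thesis by simp
    qed
  qed
qed

section \<open>Countable unions of smooth images of low-dimensional subspaces\<close>

text \<open>The strict bound makes \<open>m = 0\<close> say that \<open>Z\<close> is empty, which is
  where the later induction starts. Parameters range over subspaces of \<open>V\<close> and maps are
  defined on the whole type, so that one type serves all dimensions.\<close>

definition lowdim :: "'a::euclidean_space set \<Rightarrow> nat \<Rightarrow> 'a set \<Rightarrow> bool" where
  "lowdim V m Z \<longleftrightarrow> (\<exists>F. countable F \<and>
     (\<forall>(g, S)\<in>F. (g :: 'a \<Rightarrow> 'a) differentiable_on UNIV \<and> subspace S \<and> S \<subseteq> V \<and> dim S < m) \<and>
     Z \<subseteq> (\<Union>(g, S)\<in>F. g ` S))"

lemma lowdim_empty [simp]: "lowdim V m {}"
  unfolding lowdim_def by (rule exI [of _ "{}"]) auto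

lemma lowdim_mono: "lowdim V m Z \<Longrightarrow> Z' \<subseteq> Z \<Longrightarrow> m \<le> m' \<Longrightarrow> lowdim V m' Z'"
  unfolding lowdim_def by (elim ex_forward) (use order.strict_trans2 in blast)

lemma lowdim_UN:
  fixes V :: "'a::euclidean_space set"
  assumes "countable I" and "\<And>i. i \<in> I \<Longrightarrow> lowdim V m (Z i)"
  shows "lowdim V m (\<Union>i\<in>I. Z i)"
proof -
  have "\<forall>i\<in>I. \<exists>F. countable F \<and>
     (\<forall>(g, S)\<in>F. (g :: 'a \<Rightarrow> 'a) differentiable_on UNIV \<and> subspace S \<and> S \<subseteq> V \<and> dim S < m) \<and>
     Z i \<subseteq> (\<Union>(g, S)\<in>F. g ` S)"
    using assms(2) unfolding lowdim_def by simp
  from bchoice [OF this] obtain F where F: "\<forall>i\<in>I. countable (F i) \<and>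
     (\<forall>(g, S)\<in>F i. (g :: 'a \<Rightarrow> 'a) differentiable_on UNIV \<and> subspace S \<and> S \<subseteq> V \<and> dim S < m) \<and>
     Z i \<subseteq> (\<Union>(g, S)\<in>F i. g ` S)" by blast
  show ?thesis
    unfolding lowdim_def
  proof (intro exI conjI)
    show "countable (\<Union>i\<in>I. F i)" using assms(1) F by blast
    show "\<forall>(g, S)\<in>(\<Union>i\<in>I. F i). g differentiable_on UNIV \<and> subspace S \<and> S \<subseteq> V \<and> dim S < m"
      using F by blast
    show "(\<Union>i\<in>I. Z i) \<subseteq> (\<Union>(g, S)\<in>(\<Union>i\<in>I. F i). g ` S)"
    proof (rule UN_least)
      fix i assume i: "i \<in> I"
      then have "Z i \<subseteq> (\<Union>(g, S)\<in>F i. g ` S)" using F by blast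
      also have "\<dots> \<subseteq> (\<Union>(g, S)\<in>(\<Union>i\<in>I. F i). g ` S)"
        by (rule UN_mono) (use i in auto)
      finally show "Z i \<subseteq> (\<Union>(g, S)\<in>(\<Union>i\<in>I. F i). g ` S)" .
    qed
  qed
qed

lemma lowdim_Un:
  assumes "lowdim V m Y" "lowdim V m Z"
  shows "lowdim V m (Y \<union> Z)"
  using lowdim_UN [of "UNIV :: bool set" V m "\<lambda>b. if b then Y else Z"] assms
  by (simp add: UNIV_bool Un_commute)

lemma lowdim_affine:
  fixes V :: "'a::euclidean_space set"
  assumes "affine A" "A \<subseteq> V" "subspace V" "aff_dim A = int m"
  shows "lowdim V (Suc m) A"
proof -
  have "A \<noteq> {}" using assms(4) by auto
  then obtain c where c: "c \<in> A" by blast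
  define S where "S = (\<lambda>x. x - c) ` A"
  have S: "subspace S"
    unfolding S_def by (rule affine_diffs_subspace_subtract [OF assms(1) c])
  have "aff_dim A = aff_dim S"
    using aff_dim_translation_eq_subtract [of c A] by (simp add: S_def)
  then have "dim S = m"
    using aff_dim_subspace [OF S] assms(4) by simp
  moreover have "S \<subseteq> V"
    using assms(2,3) c by (auto simp: S_def intro: subspace_diff)
  moreover have "A \<subseteq> (\<lambda>x. c + x) ` S"
    by (force simp: S_def)
  moreover have "(\<lambda>x::'a. c + x) differentiable_on UNIV"
    by (intro differentiable_on_add differentiable_on_const) simp
  ultimately show ?thesis
    unfolding lowdim_def using S
    by (intro exI [of _ "{(\<lambda>x. c + x, S)}"]) auto
qed

text \<open>One more parameter, the coordinate \<open>w\<close> along the mapping cylinder of \<open>p\<close>, is stored in a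
  direction of \<open>V\<close> orthogonal to the old parameter space.\<close>

lemma lowdim_cylinder:
  fixes p :: "'a::euclidean_space \<Rightarrow> 'a"
  assumes Z: "lowdim V m Z" and p: "p differentiable_on UNIV" and m: "m < dim V" and V: "subspace V"
  shows "lowdim V (Suc m) {(1 - w) *\<^sub>R p z + w *\<^sub>R z | w z. z \<in> Z}"
proof -
  obtain F where F: "countable F"
    "\<forall>(g, S)\<in>F. (g :: 'a \<Rightarrow> 'a) differentiable_on UNIV \<and> subspace S \<and> S \<subseteq> V \<and> dim S < m"
    "Z \<subseteq> (\<Union>(g, S)\<in>F. g ` S)"
    using Z unfolding lowdim_def by blast
  have "\<exists>g' S'. g' differentiable_on UNIV \<and> subspace S' \<and> S' \<subseteq> V \<and> dim S' < Suc m \<and>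
      (\<forall>z\<in>g ` S. \<forall>w. (1 - w) *\<^sub>R p z + w *\<^sub>R z \<in> g' ` S')" if "(g, S) \<in> F" for g S
  proof -
    have g: "g differentiable_on UNIV" and S: "subspace S" "S \<subseteq> V" "dim S < m"
      using F(2) that by auto
    \<comment> \<open>Since \<open>dim S < m < dim V\<close>, there is room in \<open>V\<close> for
      a direction \<open>e\<close> orthogonal to \<open>S\<close>.\<close>
    have "span S \<subset> span V"
      using S V m by (metis dual_order.strict_trans less_irrefl psubsetI span_eq_iff)
    then obtain e where e: "e \<noteq> 0" "e \<in> span V" "\<And>y. y \<in> span S \<Longrightarrow> orthogonal e y"
      using orthogonal_to_subspace_exists_gen by blast
    define c where "c = inverse (e \<bullet> e)"
    have ce: "c * (e \<bullet> e) = 1" using e(1) by (simp add: c_def)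
    \<comment> \<open>\<open>c * (x \<bullet> e)\<close> is the coordinate of \<open>x\<close> along
      \<open>e\<close>. Here \<open>h\<close> discards it and evaluates \<open>g\<close> on the
      rest, while \<open>g'\<close> uses it as the cylinder parameter \<open>w\<close>.\<close>
    define h where "h x = g (x - (c * (x \<bullet> e)) *\<^sub>R e)" for x
    define g' where "g' x = (1 - c * (x \<bullet> e)) *\<^sub>R p (h x) + (c * (x \<bullet> e)) *\<^sub>R h x" for x
    have lin: "(\<lambda>x. c * (x \<bullet> e)) differentiable_on UNIV"
      by (intro linear_imp_differentiable_on) (simp add: linear_iff inner_add_left algebra_simps)
    have "(\<lambda>x. x - (c * (x \<bullet> e)) *\<^sub>R e) differentiable_on UNIV"
      by (intro linear_imp_differentiable_on) (simp add: linear_iff inner_add_left algebra_simps)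
    then have h: "h differentiable_on UNIV"
      unfolding h_def using differentiable_on_compose [of _ UNIV g] differentiable_on_subset [OF g] by blast
    then have "(\<lambda>x. p (h x)) differentiable_on UNIV"
      using differentiable_on_compose [of h UNIV p] differentiable_on_subset [OF p] by blast
    then have g': "g' differentiable_on UNIV"
      unfolding g'_def
      by (intro differentiable_on_add differentiable_on_scaleR differentiable_on_diff differentiable_on_const lin h)
    show ?thesis
    proof (intro exI conjI ballI allI)
      show "g' differentiable_on UNIV" by (rule g')
      show "subspace (span (insert e S))" by simp
      show "span (insert e S) \<subseteq> V"
        using e(2) S(2) V by (metis insert_subset span_eq_iff span_minimal)
      show "dim (span (insert e S)) < Suc m"
        using S(3) by (simp add: dim_insert)
      fix z w assume "z \<in> g ` S"
      then obtain u where u: "u \<in> S" "z = g u" by blast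
      have "u \<bullet> e = 0" using e(3) [OF span_base [OF u(1)]] by (simp add: orthogonal_def inner_commute)
      then have "c * ((u + w *\<^sub>R e) \<bullet> e) = w"
        using ce by (simp add: inner_add_left mult.left_commute)
      then have "g' (u + w *\<^sub>R e) = (1 - w) *\<^sub>R p z + w *\<^sub>R z"
        by (simp add: g'_def h_def u(2))
      moreover have "u + w *\<^sub>R e \<in> span (insert e S)"
        using u(1) by (intro span_add span_mul span_base) auto
      ultimately show "(1 - w) *\<^sub>R p z + w *\<^sub>R z \<in> g' ` span (insert e S)"
        by (metis imageI)
    qed
  qed
  then obtain G T where GT: "\<And>g S. (g, S) \<in> F \<Longrightarrow> G g S differentiable_on UNIV \<and> subspace (T g S) \<and>
      T g S \<subseteq> V \<and> dim (T g S) < Suc m \<and> (\<forall>z\<in>g ` S. \<forall>w. (1 - w) *\<^sub>R p z + w *\<^sub>R z \<in> G g S ` T g S)"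
    by metis
  show ?thesis
    unfolding lowdim_def
  proof (intro exI conjI)
    show "countable ((\<lambda>(g, S). (G g S, T g S)) ` F)" using F(1) by blast
    show "\<forall>(g, S)\<in>(\<lambda>(g, S). (G g S, T g S)) ` F. g differentiable_on UNIV \<and> subspace S \<and> S \<subseteq> V \<and> dim S < Suc m"
      using GT by force
    show "{(1 - w) *\<^sub>R p z + w *\<^sub>R z | w z. z \<in> Z} \<subseteq> (\<Union>(g, S)\<in>(\<lambda>(g, S). (G g S, T g S)) ` F. g ` S)"
    proof clarify
      fix w z assume "z \<in> Z"
      then obtain g S where "(g, S) \<in> F" "z \<in> g ` S" using F(3) by blast
      then show "(1 - w) *\<^sub>R p z + w *\<^sub>R z \<in> (\<Union>(g, S)\<in>(\<lambda>(g, S). (G g S, T g S)) ` F. g ` S)"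
        using GT by (intro UN_I [of "(G g S, T g S)"]) auto
    qed
  qed
qed

text \<open>Null sets refer to Lebesgue measure on the whole type, so each piece is thickened by the
  orthogonal complement \<open>W\<close> of \<open>V\<close>. If the pieces covered
  \<open>V\<close>, the thickened ones would be countably many null sets covering
  everything.\<close>

lemma not_lowdim_subspace:
  fixes V :: "'a::euclidean_space set"
  assumes V: "subspace V" and Z: "lowdim V (dim V) Z"
  shows "\<not> V \<subseteq> Z"
proof
  assume "V \<subseteq> Z"
  obtain F where F: "countable F"
    "\<forall>(g, S)\<in>F. (g :: 'a \<Rightarrow> 'a) differentiable_on UNIV \<and> subspace S \<and> S \<subseteq> V \<and> dim S < dim V"
    "Z \<subseteq> (\<Union>(g, S)\<in>F. g ` S)"
    using Z unfolding lowdim_def by blast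
  obtain p where p: "linear p" "\<And>x. p x \<in> V" "\<And>x y. y \<in> V \<Longrightarrow> (x - p x) \<bullet> y = 0"
    using subspace_orthogonal_projection [OF V] by blast
  define W where "W = {y. \<forall>x\<in>V. orthogonal x y}"
  have W: "dim W + dim V = DIM('a)"
    using dim_subspace_orthogonal_to_vectors [of V UNIV] V by (simp add: W_def)
  \<comment> \<open>The map applies \<open>g\<close> to the component in \<open>V\<close> and keeps
    the normal component. Its domain has dimension \<open>dim S + dim W\<close>, which is less than
    \<open>DIM('a)\<close>.\<close>
  define P where "P g S = (\<lambda>x. g (p x) + (x - p x)) ` span (S \<union> W)" for g S
  have "negligible (P g S)" if "(g, S) \<in> F" for g S
  proof -
    have g: "g differentiable_on UNIV" and S: "subspace S" "S \<subseteq> V" "dim S < dim V"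
      using F(2) that by auto
    have "dim (span (S \<union> W)) = dim S + dim W"
      using S(2) dim_orthogonal_sum [of S W] by (auto simp: W_def orthogonal_def)
    then have "negligible (span (S \<union> W))"
      using W S(3) by (intro negligible_lowdim) simp
    moreover have pd: "p differentiable_on UNIV"
      using p(1) linear_imp_differentiable_on by blast
    then have "(\<lambda>x. g (p x)) differentiable_on UNIV"
      using differentiable_on_compose [of p UNIV g] differentiable_on_subset [OF g] by blast
    then have "(\<lambda>x. g (p x) + (x - p x)) differentiable_on UNIV"
      using pd by (intro differentiable_on_add differentiable_on_diff) auto
    ultimately show ?thesis
      unfolding P_def using differentiable_on_subset
      by (intro negligible_differentiable_image_negligible) auto
  qed
  then have "negligible (case q of (g, S) \<Rightarrow> P g S)" if "q \<in> F" for q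
    using that by (cases q) simp
  then have "negligible (\<Union>(g, S)\<in>F. P g S)"
    by (metis (no_types, lifting) F(1) countable_image imageE negligible_countable_Union)
  moreover have "(\<Union>(g, S)\<in>F. P g S) = UNIV"
  proof -
    have "y \<in> (\<Union>(g, S)\<in>F. P g S)" for y
    proof -
      have "p y \<in> (\<Union>(g, S)\<in>F. g ` S)"
        using F(3) p(2) \<open>V \<subseteq> Z\<close> by (meson subsetD)
      then obtain g S where gS: "(g, S) \<in> F" "p y \<in> g ` S" by blast
      then obtain u where u: "u \<in> S" "p y = g u" by blast
      \<comment> \<open>The preimage of \<open>y\<close> has the normal part of \<open>y\<close> and
        the parameter \<open>u\<close> as its part in \<open>V\<close>.\<close>
      let ?x = "u + (y - p y)"
      have "u \<in> V" using u F(2) gS(1) by blast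
      have V': "p ?x - u \<in> V" using p(2) \<open>u \<in> V\<close> V by (simp add: subspace_diff)
      \<comment> \<open>Both differences on the right are orthogonal to \<open>V\<close>, so
        \<open>p ?x - u\<close>, which lies in \<open>V\<close>, is orthogonal to itself.\<close>
      have "p ?x - u = (y - p y) - (?x - p ?x)" by simp
      then have "(p ?x - u) \<bullet> (p ?x - u) = 0"
        using p(3) [OF V'] by (metis inner_diff_left diff_zero)
      then have "p ?x = u" by simp
      then have "g (p ?x) + (?x - p ?x) = y" using u by simp
      moreover have "y - p y \<in> W"
        using p(3) by (auto simp: W_def orthogonal_def inner_commute)
      then have "?x \<in> span (S \<union> W)"
        using u(1) by (intro span_add span_base) auto
      ultimately have "y \<in> P g S" unfolding P_def by (metis (mono_tags, lifting) imageI)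
      then show ?thesis using gS(1) by blast
    qed
    then show ?thesis by blast
  qed
  ultimately show False by simp
qed

subsection \<open>Maps of small image\<close>

text \<open>A Lindelof subfamily with the same union must contain every nonempty member, by
  disjointness. This makes \<open>lowdim_UN\<close> applicable to the families \<G>.\<close>

lemma countable_disjoint_openin:
  fixes \<F> :: "'a::second_countable_topology set set"
  assumes "\<And>S. S \<in> \<F> \<Longrightarrow> openin (top_of_set U) S" and "pairwise disjnt \<F>"
  shows "countable \<F>"
proof -
  obtain \<F>' where F: "\<F>' \<subseteq> \<F>" "countable \<F>'" "\<Union>\<F>' = \<Union>\<F>"
    using Lindelof_openin assms(1) by metis
  have "S \<in> insert {} \<F>'" if S: "S \<in> \<F>" for S
  proof (cases "S = {}")
    case False
    then obtain x T where "x \<in> S" "T \<in> \<F>'" "x \<in> T" using S F(3) by blast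
    then have "T = S" using assms(2) F(1) S by (auto simp: pairwise_def disjnt_iff)
    then show ?thesis using \<open>T \<in> \<F>'\<close> by simp
  qed simp
  then have "\<F> \<subseteq> insert {} \<F>'" by blast
  moreover have "countable (insert {} \<F>')" using F(2) by simp
  ultimately show ?thesis by (rule countable_subset)
qed

lemma continuous_on_local:
  fixes f :: "'a::topological_space \<Rightarrow> 'b::topological_space"
  assumes "\<And>x. x \<in> S \<Longrightarrow> \<exists>T. x \<in> T \<and> openin (top_of_set S) T \<and> continuous_on T f"
  shows "continuous_on S f"
  unfolding continuous_on_def
proof
  fix x assume "x \<in> S"
  then obtain T where T: "x \<in> T" "openin (top_of_set S) T" "continuous_on T f"
    using assms by blast
  obtain O' where O': "open O'" "T = S \<inter> O'" using T(2) by (auto simp: openin_open)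
  have "at x within T = at x within S"
    using T(1) O' by (intro at_within_nhd [of x O']) auto
  then show "(f \<longlongrightarrow> f x) (at x within S)"
    using T(1,3) by (metis continuous_on_def)
qed

text \<open>Outside \<open>T\<close> the map \<open>e\<close> is arbitrary, but there the factor
  \<phi> is zero; at points of \<open>S - T\<close> the bound \<open>K\<close> forces the product to
  tend to zero.\<close>

lemma continuous_on_scaleR_vanishing:
  fixes e :: "'a::topological_space \<Rightarrow> 'b::real_normed_vector"
  assumes \<phi>: "continuous_on S \<phi>" and T: "openin (top_of_set S) T" and e: "continuous_on T e"
    and 0: "\<And>x. x \<in> S - T \<Longrightarrow> \<phi> x = 0" and K: "\<And>x. x \<in> T \<Longrightarrow> norm (e x) \<le> K"
  shows "continuous_on S (\<lambda>x. \<phi> x *\<^sub>R e x)"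
  unfolding continuous_on_def
proof
  fix x assume x: "x \<in> S"
  show "((\<lambda>x. \<phi> x *\<^sub>R e x) \<longlongrightarrow> \<phi> x *\<^sub>R e x) (at x within S)"
  proof (cases "x \<in> T")
    case True
    obtain O' where O': "open O'" "T = S \<inter> O'" using T by (auto simp: openin_open)
    have "at x within T = at x within S"
      using True O' by (intro at_within_nhd [of x O']) auto
    moreover have "continuous_on T (\<lambda>x. \<phi> x *\<^sub>R e x)"
      using \<phi> O'(2) e by (intro continuous_on_scaleR) (auto intro: continuous_on_subset)
    ultimately show ?thesis using True by (metis (no_types, lifting) continuous_on_def)
  next
    case False
    have "(\<phi> \<longlongrightarrow> 0) (at x within S)"
      using \<phi> x False 0 [of x] by (metis DiffI continuous_on_def)
    then have "((\<lambda>y. \<bar>\<phi> y\<bar> * K) \<longlongrightarrow> 0) (at x within S)"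
      by (auto intro: tendsto_mult_left_zero tendsto_rabs_zero)
    moreover have "norm (\<phi> y *\<^sub>R e y) \<le> \<bar>\<phi> y\<bar> * K" if "y \<in> S" for y
      using 0 [of y] K [of y] that by (cases "y \<in> T") (auto simp: mult_left_mono)
    then have "\<forall>\<^sub>F y in at x within S. norm (\<phi> y *\<^sub>R e y) \<le> \<bar>\<phi> y\<bar> * K"
      by (simp add: eventually_at_filter)
    ultimately have "((\<lambda>y. \<phi> y *\<^sub>R e y) \<longlongrightarrow> 0) (at x within S)"
      by (rule Lim_null_comparison [rotated])
    then show ?thesis using 0 [of x] x False by simp
  qed
qed

section \<open>Construction of the displacement by induction on the dimension\<close>

text \<open>Over a member of \<G> the new values lie in the mapping cylinder from the old image,
  made of pieces of dimension below \<open>m\<close>, to an affine subspace of dimension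
  \<open>m\<close>; this has dimension at most \<open>m\<close>. A bounded displacement, unlike the
  map itself, can be cut off to zero outside \<open>H\<close>.\<close>

lemma displacement_extension_step:
  fixes V :: "'a::euclidean_space set" and M :: "('b::euclidean_space \<times> 'a) set"
  assumes V: "subspace V" and M: "snd ` M \<subseteq> V" and m: "m < dim V"
    and H: "openin (top_of_set M) H" and e: "continuous_on H e"
    and eK: "\<And>x. x \<in> H \<Longrightarrow> norm (e x) \<le> K" and eV: "\<And>x. x \<in> H \<Longrightarrow> e x \<in> V"
    and ldim: "lowdim V m ((\<lambda>x. snd x + e x) ` H)"
    and op: "\<And>G. G \<in> \<G> \<Longrightarrow> openin (top_of_set M) G" and disj: "pairwise disjnt \<G>"
    and aff: "\<And>G. G \<in> \<G> \<Longrightarrow> \<exists>A. affine A \<and> A \<subseteq> V \<and> aff_dim A = int m \<and> snd ` G \<subseteq> (\<Union>a\<in>A. ball a R)"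
  shows "\<exists>e' K'. continuous_on (H \<union> \<Union>\<G>) e' \<and> (\<forall>x\<in>H \<union> \<Union>\<G>. norm (e' x) \<le> K') \<and>
    (\<forall>x\<in>H \<union> \<Union>\<G>. e' x \<in> V) \<and> lowdim V (Suc m) ((\<lambda>x. snd x + e' x) ` (H \<union> \<Union>\<G>))"
proof -
  define G where "G = \<Union>\<G>"
  define H' where "H' = H \<union> G"
  have GM: "openin (top_of_set M) G" unfolding G_def using op by blast
  then have "H' \<subseteq> M" using H unfolding H'_def by (simp add: openin_imp_subset)
  then have opH: "openin (top_of_set H') H" and opG: "openin (top_of_set H') G"
    using openin_subset_trans [OF H, of H'] openin_subset_trans [OF GM, of H'] by (auto simp: H'_def)
  have sndV: "snd x \<in> V" if "x \<in> H'" for x using M \<open>H' \<subseteq> M\<close> that by blast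
  define K0 where "K0 = max K 0"
  have eK0: "norm (e x) \<le> K0" if "x \<in> H" for x using eK [OF that] by (simp add: K0_def)
  define nice where "nice C A p \<longleftrightarrow> affine A \<and> A \<subseteq> V \<and> aff_dim A = int m \<and>
      snd ` C \<subseteq> (\<Union>a\<in>A. ball a R) \<and> p differentiable_on UNIV \<and> (\<forall>x. p x \<in> A) \<and>
      (\<forall>x. \<forall>a\<in>A. norm (p x - x) \<le> norm (x - a))" for C :: "('b \<times> 'a) set" and A and p :: "'a \<Rightarrow> 'a"
  have "\<exists>A p. nice C A p" if C: "C \<in> \<G>" for C
  proof -
    obtain A where A: "affine A" "A \<subseteq> V" "aff_dim A = int m" "snd ` C \<subseteq> (\<Union>a\<in>A. ball a R)"
      using aff [OF C] by blast
    then have "A \<noteq> {}" by auto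
    with A(1) obtain p where "p differentiable_on UNIV" "\<And>x. p x \<in> A"
        "\<And>x a. a \<in> A \<Longrightarrow> norm (p x - x) \<le> norm (x - a)"
      using affine_orthogonal_projection by metis
    then show ?thesis using A unfolding nice_def by blast
  qed
  then obtain A p where "\<And>C. C \<in> \<G> \<Longrightarrow> nice C (A C) (p C)" by metis
  then have A: "\<And>C. C \<in> \<G> \<Longrightarrow> affine (A C)" "\<And>C. C \<in> \<G> \<Longrightarrow> A C \<subseteq> V"
      "\<And>C. C \<in> \<G> \<Longrightarrow> aff_dim (A C) = int m" "\<And>C. C \<in> \<G> \<Longrightarrow> snd ` C \<subseteq> (\<Union>a\<in>A C. ball a R)"
    and p: "\<And>C. C \<in> \<G> \<Longrightarrow> p C differentiable_on UNIV" "\<And>C x. C \<in> \<G> \<Longrightarrow> p C x \<in> A C"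
      "\<And>C x a. C \<in> \<G> \<Longrightarrow> a \<in> A C \<Longrightarrow> norm (p C x - x) \<le> norm (x - a)"
    by (simp_all add: nice_def)
  define c where "c x = (THE C. C \<in> \<G> \<and> x \<in> C)" for x
  have c: "c x = C" if "C \<in> \<G>" "x \<in> C" for x C
    unfolding c_def using disj that unfolding pairwise_def disjnt_def by (intro the_equality) blast+
  have "closedin (top_of_set H') (H' - H)" "closedin (top_of_set H') (H' - G)"
    using opH opG by (auto simp: closedin_diff)
  then obtain \<theta> where \<theta>: "continuous_on H' \<theta>"
    "\<And>x. x \<in> H' \<Longrightarrow> \<theta> x \<in> closed_segment 0 (1::real)"
    "\<And>x. x \<in> H' \<Longrightarrow> (\<theta> x = 0 \<longleftrightarrow> x \<in> H' - H)" "\<And>x. x \<in> H' \<Longrightarrow> (\<theta> x = 1 \<longleftrightarrow> x \<in> H' - G)"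
    using Urysohn_local_strong [of H' "H' - H" "H' - G" 0 "1::real"] by (auto simp: H'_def)
  \<comment> \<open>\<open>u\<close> uses the range of \<theta> up to 1/2 and \<open>w\<close> the
    rest, so \<open>w x \<noteq> 0\<close> forces \<open>u x = 1\<close>: the cylinder is entered
    only after the cut-off has ended.\<close>
  define u w where "u x = min 1 (2 * \<theta> x)" and "w x = max 0 (2 * \<theta> x - 1)" for x
  have contu: "continuous_on H' u" and contw: "continuous_on H' w"
    unfolding u_def w_def using \<theta>(1) by (auto intro!: continuous_intros)
  have u01: "0 \<le> u x" "u x \<le> 1" and w01: "0 \<le> w x" "w x \<le> 1" if "x \<in> H'" for x
    using \<theta>(2) [OF that] by (auto simp: u_def w_def closed_segment_eq_real_ivl)
  have uH: "u x = 0" and wH: "w x = 0" if "x \<in> H' - H" for x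
    using \<theta>(3) [of x] that by (auto simp: u_def w_def)
  have wG: "w x = 1" if "x \<in> H' - G" for x
    using \<theta>(4) [of x] that by (auto simp: w_def)
  define d where "d x = u x *\<^sub>R e x" for x
  have contd: "continuous_on H' d"
    unfolding d_def using contu opH e uH eK0 by (rule continuous_on_scaleR_vanishing)
  have dK: "norm (d x) \<le> K0" if "x \<in> H'" for x
  proof (cases "x \<in> H")
    case True
    then show ?thesis
      using u01 [OF that] eK0 [OF True] mult_mono [of "u x" 1 "norm (e x)" K0] by (simp add: d_def)
  next
    case False
    then show ?thesis using that uH by (simp add: d_def K0_def)
  qed
  \<comment> \<open>This is the displacement that carries \<open>snd x\<close> into the affine
    subspace of the member containing \<open>x\<close>.\<close>
  define q where "q x = p (c x) (snd x + d x) - snd x" for x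
  have contq: "continuous_on G q"
  proof (rule continuous_on_local)
    fix x assume "x \<in> G"
    then obtain C where C: "C \<in> \<G>" "x \<in> C" by (auto simp: G_def)
    then have CG: "C \<subseteq> G" by (auto simp: G_def)
    have "continuous_on UNIV (p C)"
      using p(1) [OF C(1)] by (rule differentiable_imp_continuous_on)
    moreover have "continuous_on C (\<lambda>y. snd y + d y)"
      using contd CG by (intro continuous_intros) (auto intro: continuous_on_subset simp: H'_def)
    ultimately have "continuous_on C (\<lambda>y. p C (snd y + d y) - snd y)"
      by (intro continuous_intros) (auto intro: continuous_on_compose2)
    then have "continuous_on C q"
      by (rule continuous_on_eq) (use c C in \<open>auto simp: q_def\<close>)
    moreover have "openin (top_of_set G) C"
      using op C(1) CG openin_imp_subset [OF GM] by (blast intro: openin_subset_trans)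
    ultimately show "\<exists>T. x \<in> T \<and> openin (top_of_set G) T \<and> continuous_on T q"
      using C by blast
  qed
  \<comment> \<open>One \<open>K0\<close> comes from the distance of \<open>snd x + d x\<close> to
    the affine subspace, bounded by minimality of \<open>p C\<close>, the other from
    \<open>d x\<close> itself.\<close>
  have qK: "norm (q x) \<le> R + 2 * K0" if xG: "x \<in> G" for x
  proof -
    obtain C where C: "C \<in> \<G>" "x \<in> C" using xG by (auto simp: G_def)
    obtain a where a: "a \<in> A C" "dist a (snd x) < R" using A(4) [OF C(1)] C(2) by force
    define z where "z = snd x + d x"
    have "norm (p C z - z) \<le> norm (z - a)" using p(3) C(1) a(1) by blast
    moreover have "norm (z - a) \<le> norm (snd x - a) + norm (d x)"
      using norm_triangle_ineq [of "snd x - a" "d x"] by (simp add: z_def algebra_simps)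
    moreover have "norm (snd x - a) < R" using a(2) by (simp add: dist_norm norm_minus_commute)
    moreover have "norm (d x) \<le> K0" using dK xG by (simp add: H'_def)
    moreover have "q x = (p C z - z) + d x" using c [OF C] by (simp add: q_def z_def)
    then have "norm (q x) \<le> norm (p C z - z) + norm (d x)" by (simp add: norm_triangle_ineq)
    ultimately show ?thesis by linarith
  qed
  have qV: "q x \<in> V" if xG: "x \<in> G" for x
  proof -
    obtain C where C: "C \<in> \<G>" "x \<in> C" using xG by (auto simp: G_def)
    then have "p C (snd x + d x) \<in> V" using A(2) p(2) by blast
    then show ?thesis
      using c [OF C] sndV [of x] xG V by (simp add: q_def H'_def subspace_diff)
  qed
  \<comment> \<open>As \<open>\<theta>\<close> grows to \<open>1/2\<close> the value moves inside the affine subspace from the image of \<open>snd x\<close> to that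
    of \<open>snd x + e x\<close>; only then does it move along the cylinder. Interpolating directly would
    raise the dimension too much.\<close>
  define e' where "e' x = (1 - w x) *\<^sub>R q x + w x *\<^sub>R e x" for x
  have "continuous_on H' (\<lambda>x. (1 - w x) *\<^sub>R q x)"
    by (rule continuous_on_scaleR_vanishing [OF _ opG contq _ qK])
      (use contw wG in \<open>auto intro!: continuous_intros\<close>)
  moreover have "continuous_on H' (\<lambda>x. w x *\<^sub>R e x)"
    using contw opH e wH eK0 by (rule continuous_on_scaleR_vanishing)
  ultimately have cont: "continuous_on H' e'"
    unfolding e'_def by (rule continuous_on_add)
  have bdd: "norm (e' x) \<le> \<bar>R + 2 * K0\<bar> + K0" if "x \<in> H'" for x
  proof -
    have "norm ((1 - w x) *\<^sub>R q x) \<le> \<bar>R + 2 * K0\<bar>"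
    proof (cases "x \<in> G")
      case True
      then show ?thesis
        using w01 [OF that] qK [OF True] mult_mono [of "1 - w x" 1 "norm (q x)" "\<bar>R + 2 * K0\<bar>"] by simp
    qed (use wG that in simp)
    moreover have "norm (w x *\<^sub>R e x) \<le> K0"
    proof (cases "x \<in> H")
      case True
      then show ?thesis
        using w01 [OF that] eK0 [OF True] mult_mono [of "w x" 1 "norm (e x)" K0] by simp
    qed (use wH that in \<open>simp add: K0_def\<close>)
    ultimately show ?thesis unfolding e'_def using norm_triangle_le by (metis add_mono)
  qed
  have inV: "e' x \<in> V" if "x \<in> H'" for x
  proof -
    have "(1 - w x) *\<^sub>R q x \<in> V"
      using qV [of x] wG [of x] that V by (cases "x \<in> G") (auto simp: subspace_scale subspace_0)
    moreover have "w x *\<^sub>R e x \<in> V"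
      using eV [of x] wH [of x] that V by (cases "x \<in> H") (auto simp: subspace_scale subspace_0)
    ultimately show ?thesis using V by (simp add: e'_def subspace_add)
  qed
  define Z where "Z = (\<lambda>x. snd x + e x) ` H"
  \<comment> \<open>\<open>A C\<close> receives the points of \<open>C\<close> with
    \<open>w x = 0\<close>, the cylinder the other points of \<open>C\<close>. Points outside
    \<open>G\<close> keep their old values in \<open>Z\<close>.\<close>
  define Y where "Y C = A C \<union> {(1 - w) *\<^sub>R p C z + w *\<^sub>R z | w z. z \<in> Z}" for C
  have "lowdim V (Suc m) (Y C)" if "C \<in> \<G>" for C
    unfolding Y_def using A p that ldim m V unfolding Z_def
    by (intro lowdim_Un lowdim_affine lowdim_cylinder) auto
  moreover have "countable \<G>" using op disj countable_disjoint_openin by blast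
  ultimately have "lowdim V (Suc m) (\<Union>C\<in>\<G>. Y C)" by (intro lowdim_UN)
  moreover have "lowdim V (Suc m) Z" using ldim by (auto simp: Z_def intro: lowdim_mono)
  ultimately have "lowdim V (Suc m) ((\<Union>C\<in>\<G>. Y C) \<union> Z)" by (rule lowdim_Un)
  moreover have "snd x + e' x \<in> (\<Union>C\<in>\<G>. Y C) \<union> Z" if x: "x \<in> H'" for x
  proof (cases "x \<in> G")
    case False
    then have "w x = 1" "x \<in> H" using wG x by (auto simp: H'_def)
    then show ?thesis by (simp add: e'_def Z_def)
  next
    case True
    then obtain C where C: "C \<in> \<G>" "x \<in> C" by (auto simp: G_def)
    have "snd x + e' x \<in> Y C"
    proof (cases "w x = 0")
      case True
      then have "snd x + e' x = p C (snd x + d x)"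
        using c [OF C] by (simp add: e'_def q_def)
      then show ?thesis using p(2) C by (simp add: Y_def)
    next
      case False
      then have "x \<in> H" using wH x by blast
      have "u x = 1" using False by (auto simp: u_def w_def)
      then have "snd x + e' x = (1 - w x) *\<^sub>R p C (snd x + e x) + w x *\<^sub>R (snd x + e x)"
        using c [OF C] by (simp add: e'_def q_def d_def algebra_simps)
      moreover have "snd x + e x \<in> Z" using \<open>x \<in> H\<close> by (simp add: Z_def)
      ultimately show ?thesis unfolding Y_def by blast
    qed
    then show ?thesis using C by blast
  qed
  then have "(\<lambda>x. snd x + e' x) ` H' \<subseteq> (\<Union>C\<in>\<G>. Y C) \<union> Z" by blast
  ultimately have "lowdim V (Suc m) ((\<lambda>x. snd x + e' x) ` H')"
    using lowdim_mono by blast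
  then show ?thesis
    using cont bdd inV unfolding H'_def G_def by blast
qed

text \<open>The index of a family is the dimension of its affine subspaces, so each step raises the
  strict bound by one, starting from the empty union.\<close>

lemma displacement_exists:
  fixes V :: "'a::euclidean_space set" and M :: "('b::euclidean_space \<times> 'a) set"
  assumes V: "subspace V" and M: "snd ` M \<subseteq> V"
    and op: "\<And>i G. i < dim V \<Longrightarrow> G \<in> \<G> i \<Longrightarrow> openin (top_of_set M) G"
    and disj: "\<And>i. i < dim V \<Longrightarrow> pairwise disjnt (\<G> i)"
    and aff: "\<And>i G. i < dim V \<Longrightarrow> G \<in> \<G> i \<Longrightarrow>
      \<exists>A. affine A \<and> A \<subseteq> V \<and> aff_dim A = int i \<and> snd ` G \<subseteq> (\<Union>a\<in>A. ball a R)"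
    and "m \<le> dim V"
  shows "\<exists>e K. continuous_on (\<Union>i<m. \<Union>(\<G> i)) e \<and> (\<forall>x\<in>\<Union>i<m. \<Union>(\<G> i). norm (e x) \<le> K) \<and>
    (\<forall>x\<in>\<Union>i<m. \<Union>(\<G> i). e x \<in> V) \<and> lowdim V m ((\<lambda>x. snd x + e x) ` (\<Union>i<m. \<Union>(\<G> i)))"
  using \<open>m \<le> dim V\<close>
proof (induction m)
  case 0
  then show ?case by auto
next
  case (Suc m)
  then have m: "m < dim V" by simp
  define H where "H = (\<Union>i<m. \<Union>(\<G> i))"
  have eq: "(\<Union>i<Suc m. \<Union>(\<G> i)) = H \<union> \<Union>(\<G> m)"
    by (auto simp: H_def lessThan_Suc)
  obtain e K where e: "continuous_on H e" "\<forall>x\<in>H. norm (e x) \<le> K" "\<forall>x\<in>H. e x \<in> V"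
      "lowdim V m ((\<lambda>x. snd x + e x) ` H)"
    using Suc.IH m unfolding H_def by (meson less_imp_le)
  have "openin (top_of_set M) (\<Union>(\<G> i))" if "i < m" for i
    using op [OF less_trans [OF that m]] by (rule openin_Union)
  then have oH: "openin (top_of_set M) H"
    unfolding H_def by (intro openin_Union) blast
  show ?case
    unfolding eq
  proof (rule displacement_extension_step [OF V M m oH, where e = e and K = K and R = R])
    show "continuous_on H e" by (rule e(1))
    show "lowdim V m ((\<lambda>x. snd x + e x) ` H)" by (rule e(4))
    show "pairwise disjnt (\<G> m)" using disj m by blast
    show "openin (top_of_set M) G" if "G \<in> \<G> m" for G using op m that by blast
    show "norm (e x) \<le> K" if "x \<in> H" for x using e(2) that by blast
    show "e x \<in> V" if "x \<in> H" for x using e(3) that by blast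
    show "\<exists>A. affine A \<and> A \<subseteq> V \<and> aff_dim A = int m \<and> snd ` G \<subseteq> (\<Union>a\<in>A. ball a R)"
      if "G \<in> \<G> m" for G using aff m that by blast
  qed
qed

subsection \<open>Coloured covers of a simplex times a space\<close>

text \<open>The distance to \<open>M - U\<close> serves unless that set is empty; then
  \<open>infdist\<close> would be 0 and the constant 1 replaces it. The common Lipschitz constant
  controls infinitely many such functions at once.\<close>

lemma openin_positivity_function:
  fixes U :: "'a::metric_space set"
  assumes "openin (top_of_set M) U"
  obtains d :: "'a \<Rightarrow> real" where "\<And>x. 0 \<le> d x" "\<And>x y. \<bar>d x - d y\<bar> \<le> dist x y"
    "\<And>x. x \<in> M \<Longrightarrow> 0 < d x \<longleftrightarrow> x \<in> U"
proof (cases "M \<subseteq> U")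
  case True
  then show ?thesis using that [of "\<lambda>_. 1"] by auto
next
  case False
  obtain T where T: "open T" "U = M \<inter> T" using assms by (auto simp: openin_open)
  show ?thesis
  proof (rule that [of "\<lambda>x. infdist x (M - U)"])
    show "0 < infdist x (M - U) \<longleftrightarrow> x \<in> U" if "x \<in> M" for x
    proof -
      have "closure (M - U) \<subseteq> - T"
        using T by (intro closure_minimal) auto
      then have "x \<in> closure (M - U) \<longleftrightarrow> x \<notin> U"
        using T(2) that closure_subset [of "M - U"] by blast
      then show ?thesis
        using False in_closure_iff_infdist_zero [of "M - U" x] infdist_nonneg [of x "M - U"]
        by (auto simp: less_le)
    qed
  qed (auto simp: infdist_nonneg infdist_triangle_abs)
qed

lemma continuous_on_lipschitz_real:
  fixes d :: "'a::metric_space \<Rightarrow> real"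
  assumes "\<And>x y. \<bar>d x - d y\<bar> \<le> dist x y"
  shows "continuous_on S d"
proof (rule continuous_onI)
  fix x and \<epsilon> :: real assume "0 < \<epsilon>"
  moreover have "dist (d y) (d x) \<le> \<epsilon>" if "dist y x < \<epsilon>" for y
    using assms [of y x] that by (simp add: dist_real_def)
  ultimately show "\<exists>\<delta>>0. \<forall>y\<in>S. dist y x < \<delta> \<longrightarrow> dist (d y) (d x) \<le> \<epsilon>" by blast
qed

section \<open>Barycentric coordinates on the standard simplex\<close>

lemma sum_axis:
  fixes x :: "real ^ 'n"
  shows "(\<Sum>i\<in>UNIV. (x $ i) *\<^sub>R axis i 1) = x"
  by (simp add: vec_eq_iff axis_def if_distrib cong: if_cong)

lemma mem_std_simplex:
  fixes x :: "real ^ 'n"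
  shows "x \<in> std_simplex \<longleftrightarrow> (\<forall>j. 0 \<le> x $ j) \<and> (\<Sum>j\<in>UNIV. x $ j) = 1"
proof
  assume "x \<in> std_simplex"
  moreover have "std_simplex \<subseteq> {x :: real ^ 'n. (\<forall>j. 0 \<le> x $ j) \<and> (\<Sum>j\<in>UNIV. x $ j) = 1}"
    unfolding std_simplex_def
  proof (rule hull_minimal)
    show "convex {x :: real ^ 'n. (\<forall>j. 0 \<le> x $ j) \<and> (\<Sum>j\<in>UNIV. x $ j) = 1}"
      by (auto simp: convex_def sum.distrib simp flip: sum_distrib_left)
  qed (auto simp: axis_def)
  ultimately show "(\<forall>j. 0 \<le> x $ j) \<and> (\<Sum>j\<in>UNIV. x $ j) = 1" by blast
next
  assume "(\<forall>j. 0 \<le> x $ j) \<and> (\<Sum>j\<in>UNIV. x $ j) = 1"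
  then have "(\<Sum>i\<in>UNIV. (x $ i) *\<^sub>R axis i 1) \<in> (std_simplex :: (real ^ 'n) set)"
    unfolding std_simplex_def by (intro convex_sum) (auto intro: hull_inc)
  then show "x \<in> std_simplex" by (simp add: sum_axis)
qed

lemma mem_opp_face:
  fixes x :: "real ^ 'n"
  assumes "x \<in> std_simplex" "x $ j = 0"
  shows "x \<in> opp_face j"
proof -
  have s: "(\<Sum>i\<in>UNIV. f i) = (\<Sum>i\<in>UNIV - {j}. f i)" if "f j = 0" for f :: "'n \<Rightarrow> 'b::comm_monoid_add"
    using that by (simp add: sum.remove [of UNIV j])
  have "(\<Sum>i\<in>UNIV - {j}. (x $ i) *\<^sub>R axis i 1) \<in> opp_face j"
    unfolding opp_face_def
  proof (rule convex_sum)
    show "(\<Sum>i\<in>UNIV - {j}. x $ i) = 1"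
      using assms s [of "\<lambda>i. x $ i"] by (simp add: mem_std_simplex)
  qed (use assms in \<open>auto simp: mem_std_simplex intro: hull_inc\<close>)
  moreover have "(\<Sum>i\<in>UNIV - {j}. (x $ i) *\<^sub>R axis i 1) = x"
    using sum_axis [of x] s [of "\<lambda>i. (x $ i) *\<^sub>R (axis i 1 :: real ^ 'n)"] assms(2) by simp
  ultimately show ?thesis by simp
qed

lemma compact_std_simplex: "compact (std_simplex :: (real ^ 'n) set)"
  unfolding std_simplex_def by (simp add: finite_imp_compact_convex_hull)

lemma convex_std_simplex: "convex (std_simplex :: (real ^ 'n) set)"
  by (simp add: std_simplex_def)

lemma std_simplex_nonempty: "(std_simplex :: (real ^ 'n) set) \<noteq> {}"
  by (simp add: std_simplex_def)

text \<open>A form of the Knaster-Kuratowski-Mazurkiewicz lemma with parameters in \<open>V\<close>: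
  Brouwer's theorem finds a common point of the \<open>P j\<close> and solves the equation in
  \<open>V\<close> at the same time.\<close>

lemma simplex_cover_surj:
  fixes P :: "'n \<Rightarrow> ((real ^ 'n) \<times> 'a::euclidean_space) set"
  assumes V: "subspace V" and M: "M = std_simplex \<times> V"
    and op: "\<And>j. openin (top_of_set M) (P j)"
    and cover: "M \<subseteq> (\<Union>j. P j)"
    and face: "\<And>j. P j \<inter> (opp_face j \<times> V) = {}"
    and cont: "continuous_on (\<Inter>j. P j) e"
    and bdd: "\<And>x. x \<in> (\<Inter>j. P j) \<Longrightarrow> norm (e x) \<le> K"
    and eV: "\<And>x. x \<in> (\<Inter>j. P j) \<Longrightarrow> e x \<in> V"
    and v: "v \<in> V"
  obtains x where "x \<in> (\<Inter>j. P j)" "snd x + e x = v"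
proof -
  have "\<exists>d. (\<forall>x. 0 \<le> d x) \<and> (\<forall>x y. \<bar>d x - d y\<bar> \<le> dist x y) \<and> (\<forall>x\<in>M. 0 < d x \<longleftrightarrow> x \<in> P j)" for j
    using openin_positivity_function [OF op] by metis
  then obtain d where d0: "\<And>j x. 0 \<le> d j x" and dl: "\<And>j x y. \<bar>d j x - d j y\<bar> \<le> dist x y"
    and dP: "\<And>j x. x \<in> M \<Longrightarrow> 0 < d j x \<longleftrightarrow> x \<in> P j"
    by metis
  define S where "S x = (\<Sum>j\<in>UNIV. d j x)" for x
  have Spos: "0 < S x" if x: "x \<in> M" for x
  proof -
    obtain j where "x \<in> P j" using cover x by blast
    then have "0 < d j x" using dP x by blast
    then show ?thesis unfolding S_def using d0 by (intro sum_pos2 [of UNIV j]) auto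
  qed
  define y where "y j x = d j x / S x" for j x
  have y0: "0 \<le> y j x" if "x \<in> M" for j x
    using d0 Spos [OF that] by (simp add: y_def)
  have y1: "(\<Sum>j\<in>UNIV. y j x) = 1" if "x \<in> M" for x
    using Spos [OF that] unfolding y_def by (simp add: S_def flip: sum_divide_distrib)
  have contd: "continuous_on M (d j)" for j
    using dl continuous_on_lipschitz_real by blast
  have contS: "continuous_on M S"
    unfolding S_def by (intro continuous_on_sum contd)
  have conty: "continuous_on M (y j)" for j
    unfolding y_def using Spos by (intro continuous_on_divide contd contS) force
  have y_face: "y j x = 0" if "x \<in> M" "fst x $ j = 0" for j x
  proof -
    have "x \<in> opp_face j \<times> V"
      using that mem_opp_face [of "fst x" j] by (auto simp: M)
    then have "\<not> 0 < d j x" using face dP that(1) by blast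
    then show ?thesis using d0 [of j x] by (simp add: y_def)
  qed
  \<comment> \<open>The functions \<open>y j\<close> map \<open>M\<close> to the simplex;
    \<open>b\<close> is each coordinate of the barycentre and \<open>B\<close> is the preimage of
    the barycentre, a closed set on which all \<open>d j\<close> are positive.\<close>
  define b where "b = 1 / real CARD('n)"
  have b: "0 < b" "(\<Sum>j\<in>(UNIV :: 'n set). b) = 1" by (auto simp: b_def)
  define B where "B = {x \<in> M. \<forall>j. y j x = b}"
  have "closedin (top_of_set M) {x \<in> M. y j x = b}" for j
    using conty continuous_closedin_preimage_constant by blast
  then have "closedin (top_of_set M) (\<Inter>j. {x \<in> M. y j x = b})"
    by (intro closedin_Inter) auto
  moreover have "(\<Inter>j. {x \<in> M. y j x = b}) = B" by (auto simp: B_def)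
  ultimately have clB: "closedin (top_of_set M) B" by simp
  have BP: "B \<subseteq> (\<Inter>j. P j)"
  proof clarify
    fix x j assume x: "x \<in> B"
    then have "x \<in> M" "0 < y j x" using b by (auto simp: B_def)
    then have "0 < d j x" using Spos by (simp add: y_def zero_less_divide_iff d0) (use d0 [of j x] in linarith)
    then show "x \<in> P j" using dP \<open>x \<in> M\<close> by blast
  qed
  define L where "L = max K 0"
  have "convex (V \<inter> cball 0 L)"
    using V by (simp add: convex_Int subspace_imp_convex)
  moreover have "0 \<in> V \<inter> cball 0 L" using V by (auto simp: subspace_0 L_def)
  then have "V \<inter> cball 0 L \<noteq> {}" by blast
  moreover have "continuous_on B e" using cont BP continuous_on_subset by blast
  moreover have "e ` B \<subseteq> V \<inter> cball 0 L"
  proof clarify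
    fix x assume "x \<in> B"
    then have "x \<in> (\<Inter>j. P j)" using BP by blast
    then show "e x \<in> V \<inter> cball 0 L" using eV [of x] bdd [of x] by (simp add: L_def)
  qed
  \<comment> \<open>\<open>e\<close> is controlled only on the intersection of the
    \<open>P j\<close>. Its restriction to the closed set \<open>B\<close> extends to all of
    \<open>M\<close> with values in the same convex set.\<close>
  ultimately obtain g where g: "continuous_on M g" "g ` M \<subseteq> V \<inter> cball 0 L" "\<And>x. x \<in> B \<Longrightarrow> g x = e x"
    using Dugundji [OF _ _ clB] by metis
  define T where "T x = 1 + (\<Sum>i\<in>UNIV. max 0 (b - y i x))" for x
  have Tpos: "1 \<le> T x" for x by (simp add: T_def sum_nonneg)
  \<comment> \<open>As in Nash's theorem, coordinates with \<open>y j x < b\<close> are pushed up and the result renormalised.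
    Since \<open>y j\<close> vanishes on the face \<open>j\<close>, a fixed point has \<open>y j x = b\<close> for all \<open>j\<close>.\<close>
  define f where "f x = ((\<chi> j. (fst x $ j + max 0 (b - y j x)) / T x), v - g x)" for x
  \<comment> \<open>As \<open>g\<close> has values in \<open>cball 0 L\<close>,
    \<open>v - g x\<close> stays in \<open>cball v L\<close>; so \<open>f\<close> maps this compact
    convex set to itself.\<close>
  define Q where "Q = (std_simplex :: (real ^ 'n) set) \<times> (V \<inter> cball v L)"
  have QM: "Q \<subseteq> M" by (auto simp: Q_def M)
  have contT: "continuous_on Q T"
    unfolding T_def using conty QM continuous_on_subset by (intro continuous_intros) blast
  obtain x where x: "x \<in> Q" "f x = x"
  proof (rule brouwer [of Q f])
    show "compact Q"
      unfolding Q_def using V compact_std_simplex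
      by (intro compact_Times) (auto simp: closed_subspace closed_Int_compact)
    show "convex Q"
      unfolding Q_def using V convex_std_simplex
      by (intro convex_Times convex_Int) (auto simp: subspace_imp_convex)
    have "v \<in> V \<inter> cball v L" using v by (auto simp: L_def)
    then show "Q \<noteq> {}" unfolding Q_def using std_simplex_nonempty by blast
    show "continuous_on Q f"
      unfolding f_def using Tpos conty g(1) QM contT
      by (intro continuous_intros) (auto intro: continuous_on_subset, metis not_one_le_zero)
    show "f \<in> Q \<rightarrow> Q"
    proof
      fix x assume x: "x \<in> Q"
      then have xM: "x \<in> M" using QM by blast
      then have s: "fst x \<in> std_simplex" by (auto simp: M)
      have "(\<Sum>j\<in>UNIV. (fst x $ j + max 0 (b - y j x)) / T x) = 1"
        using s Tpos [of x] by (simp add: sum.distrib T_def mem_std_simplex flip: sum_divide_distrib)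
      moreover have "0 \<le> (fst x $ j + max 0 (b - y j x)) / T x" for j
        using s Tpos [of x] by (simp add: mem_std_simplex)
      ultimately have "fst (f x) \<in> std_simplex" by (simp add: f_def mem_std_simplex)
      moreover have "snd (f x) \<in> V \<inter> cball v L"
        using g(2) xM v V by (auto simp: f_def dist_norm subspace_diff)
      ultimately show "f x \<in> Q" by (metis Q_def mem_Sigma_iff prod.collapse)
    qed
  qed
  have xM: "x \<in> M" using x(1) QM by blast
  then have s: "\<And>j. 0 \<le> fst x $ j" by (auto simp: M mem_std_simplex)
  have fx: "fst x $ j * (T x - 1) = max 0 (b - y j x)" for j
  proof -
    have "fst x $ j = fst (f x) $ j" using x(2) by simp
    also have "\<dots> = (fst x $ j + max 0 (b - y j x)) / T x" by (simp add: f_def)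
    finally show ?thesis using Tpos [of x] by (simp add: field_simps)
  qed
  have "T x = 1"
  proof (rule ccontr)
    assume "T x \<noteq> 1"
    then have T1: "0 < T x - 1" using Tpos [of x] by simp
    \<comment> \<open>On the face \<open>y j x\<close> vanishes; off it, \<open>T x > 1\<close>
      makes the left side of \<open>fx\<close> positive. All coordinates below \<open>b\<close>
      contradict their sum being 1.\<close>
    have "y j x < b" for j
    proof (cases "fst x $ j = 0")
      case True
      then show ?thesis using y_face [OF xM] b by simp
    next
      case False
      then have "0 < max 0 (b - y j x)" using s [of j] fx [of j] T1 by (metis less_le mult_pos_pos)
      then show ?thesis by simp
    qed
    then have "(\<Sum>j\<in>UNIV. y j x) < (\<Sum>j\<in>(UNIV :: 'n set). b)"
      by (intro sum_strict_mono) auto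
    then show False using b y1 [OF xM] by simp
  qed
  then have le: "b \<le> y j x" for j using fx [of j] by simp
  have "y j x = b" for j
  proof (rule ccontr)
    assume "y j x \<noteq> b"
    then have "(\<Sum>j\<in>(UNIV :: 'n set). b) < (\<Sum>j\<in>UNIV. y j x)"
      using le by (intro sum_strict_mono_ex1) (auto simp: less_le intro!: exI [of _ j])
    then show False using b y1 [OF xM] by simp
  qed
  then have xB: "x \<in> B" using xM by (simp add: B_def)
  have "snd x = v - e x" using x(2) g(3) [OF xB] unfolding f_def by (metis snd_conv)
  then have "snd x + e x = v" by simp
  with BP xB show ?thesis by (intro that [of x]) blast+
qed

subsection \<open>Disjoint families from a cover of finite order\<close>

text \<open>A point is assigned to a set \<V> of elements when its distances for \<V> exceed those
  for all others. Two different sets of the same size would order some pair of elements in opposite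
  ways, which gives disjointness.\<close>

lemma disjoint_open_families:
  fixes M :: "'b::euclidean_space set"
  assumes M: "locally connected M"
    and op: "\<And>W. W \<in> \<W> \<Longrightarrow> openin (top_of_set M) W"
    and cover: "M \<subseteq> \<Union>\<W>"
    and mult: "\<And>x. x \<in> M \<Longrightarrow> finite {W \<in> \<W>. x \<in> W} \<and> card {W \<in> \<W>. x \<in> W} \<le> n"
  shows "\<exists>\<G> :: nat \<Rightarrow> 'b set set. (\<forall>k. \<forall>G\<in>\<G> k. openin (top_of_set M) G) \<and> (\<forall>k. pairwise disjnt (\<G> k)) \<and>
    M \<subseteq> (\<Union>k\<in>{1..n}. \<Union>(\<G> k)) \<and>
    (\<forall>k. \<forall>G\<in>\<G> k. \<exists>\<V> C. \<V> \<subseteq> \<W> \<and> finite \<V> \<and> card \<V> = k \<and> C \<in> components (\<Inter>\<V>) \<and> G \<subseteq> C)"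
proof -
  define good where "good W d \<longleftrightarrow> (\<forall>x y. \<bar>d x - d y\<bar> \<le> dist x y) \<and> (\<forall>x. 0 \<le> d x) \<and>
      (\<forall>x\<in>M. 0 < d x \<longleftrightarrow> x \<in> W)" for W :: "'b set" and d :: "'b \<Rightarrow> real"
  have "\<exists>d. good W d" if "W \<in> \<W>" for W
    unfolding good_def using openin_positivity_function [OF op [OF that]] by metis
  then obtain d where "\<And>W. W \<in> \<W> \<Longrightarrow> good W (d W)" by metis
  then have dl: "\<And>W x y. W \<in> \<W> \<Longrightarrow> \<bar>d W x - d W y\<bar> \<le> dist x y"
    and d0: "\<And>W x. W \<in> \<W> \<Longrightarrow> 0 \<le> d W x"
    and dW: "\<And>W x. W \<in> \<W> \<Longrightarrow> x \<in> M \<Longrightarrow> 0 < d W x \<longleftrightarrow> x \<in> W"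
    by (simp_all add: good_def)
  \<comment> \<open>\<W> may be infinite, so pointwise strict inequalities need not persist nearby;
    the interval from \<open>a\<close> to \<open>b\<close> does persist when shrunk. The condition
    \<open>0 \<le> a\<close> makes all \<open>d W x\<close> with \<open>W\<close> in \<V>
    positive.\<close>
  define gap where "gap \<V> = {x \<in> M. \<exists>a b. 0 \<le> a \<and> a < b \<and> (\<forall>W\<in>\<V>. b \<le> d W x) \<and> (\<forall>W\<in>\<W> - \<V>. d W x \<le> a)}" for \<V>
  have gap_open: "openin (top_of_set M) (gap \<V>)" if V: "\<V> \<subseteq> \<W>" for \<V>
    unfolding openin_contains_ball
  proof (intro conjI ballI)
    show "gap \<V> \<subseteq> M" by (auto simp: gap_def)
    fix x assume "x \<in> gap \<V>"
    then obtain a b where ab: "0 \<le> a" "a < b" "\<And>W. W \<in> \<V> \<Longrightarrow> b \<le> d W x" "\<And>W. W \<in> \<W> - \<V> \<Longrightarrow> d W x \<le> a"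
      unfolding gap_def by blast
    \<comment> \<open>Moving both ends inwards by a third of the length still leaves a gap.\<close>
    define \<epsilon> where "\<epsilon> = (b - a) / 3"
    have "0 < \<epsilon>" using ab by (simp add: \<epsilon>_def)
    moreover have "y \<in> gap \<V>" if y: "y \<in> ball x \<epsilon> \<inter> M" for y
    proof -
      have "dist x y < \<epsilon>" "y \<in> M" using y by auto
      have "b - \<epsilon> \<le> d W y" if "W \<in> \<V>" for W
      proof -
        have "W \<in> \<W>" using V that by blast
        then show ?thesis using dl [of W x y] ab(3) [OF that] \<open>dist x y < \<epsilon>\<close> by linarith
      qed
      moreover have "d W y \<le> a + \<epsilon>" if "W \<in> \<W> - \<V>" for W
      proof -
        have "W \<in> \<W>" using that by blast
        then show ?thesis using dl [of W x y] ab(4) [OF that] \<open>dist x y < \<epsilon>\<close> by linarith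
      qed
      moreover have "0 \<le> a + \<epsilon>" "a + \<epsilon> < b - \<epsilon>"
        using ab by (auto simp: \<epsilon>_def field_simps)
      ultimately show ?thesis
        unfolding gap_def using \<open>y \<in> M\<close> by blast
    qed
    ultimately show "\<exists>e>0. ball x e \<inter> M \<subseteq> gap \<V>" by blast
  qed
  have gap_sub: "gap \<V> \<subseteq> \<Inter>\<V>" if "\<V> \<subseteq> \<W>" for \<V>
  proof (intro subsetI InterI)
    fix x W assume x: "x \<in> gap \<V>" and W: "W \<in> \<V>"
    then have "0 < d W x" "x \<in> M" unfolding gap_def by force+
    then show "x \<in> W" using dW W that by blast
  qed
  have gap_less: "d W' x < d W x" if x: "x \<in> gap \<V>" and W: "W \<in> \<V>" "W' \<in> \<W> - \<V>" for \<V> x W W'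
  proof -
    obtain a b where "a < b" "\<forall>W\<in>\<V>. b \<le> d W x" "\<forall>W\<in>\<W> - \<V>. d W x \<le> a"
      using x unfolding gap_def by blast
    then have "d W' x \<le> a" "a < b" "b \<le> d W x" using W by blast+
    then show ?thesis by linarith
  qed
  have gap_disj: "gap \<V> \<inter> gap \<V>' = {}"
    if V: "\<V> \<subseteq> \<W>" "\<V>' \<subseteq> \<W>" "finite \<V>" "finite \<V>'" "card \<V> = card \<V>'" "\<V> \<noteq> \<V>'" for \<V> \<V>'
  proof -
    \<comment> \<open>Distinct finite sets of equal size are not contained in one another.\<close>
    obtain W W' where W: "W \<in> \<V> - \<V>'" "W' \<in> \<V>' - \<V>"
      using V card_subset_eq [of \<V> \<V>'] card_subset_eq [of \<V>' \<V>] by auto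
    have False if x: "x \<in> gap \<V>" "x \<in> gap \<V>'" for x
    proof -
      have "d W' x < d W x"
        using x(1) W V(2) by (intro gap_less [of x \<V>]) auto
      moreover have "d W x < d W' x"
        using x(2) W V(1) by (intro gap_less [of x \<V>']) auto
      ultimately show False by simp
    qed
    then show ?thesis by blast
  qed
  \<comment> \<open>Components are taken because the hypotheses on the cover concern components;
    local connectedness keeps them open. Index 0 belongs to the empty \<V>, so the covering claim
    starts at 1.\<close>
  define \<G> where "\<G> k = {G. \<exists>\<V>. \<V> \<subseteq> \<W> \<and> finite \<V> \<and> card \<V> = k \<and> G \<in> components (gap \<V>)}" for k
  show ?thesis
  proof (rule exI [of _ \<G>], intro conjI allI ballI)
    fix k G assume "G \<in> \<G> k"
    then obtain \<V> where V: "\<V> \<subseteq> \<W>" "finite \<V>" "card \<V> = k" "G \<in> components (gap \<V>)"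
      unfolding \<G>_def by blast
    have "openin (top_of_set (gap \<V>)) G"
      using locally_open_subset [OF M gap_open [OF V(1)]] V(4) by (rule openin_components_locally_connected)
    then show "openin (top_of_set M) G" using gap_open [OF V(1)] by (rule openin_trans)
  next
    fix k
    show "pairwise disjnt (\<G> k)"
    proof (rule pairwiseI)
      fix G G' assume "G \<in> \<G> k" "G' \<in> \<G> k" "G \<noteq> G'"
      then obtain \<V> \<V>' where V: "\<V> \<subseteq> \<W>" "\<V>' \<subseteq> \<W>" "finite \<V>" "finite \<V>'" "card \<V> = card \<V>'"
          "G \<in> components (gap \<V>)" "G' \<in> components (gap \<V>')"
        unfolding \<G>_def by force
      show "disjnt G G'"
      proof (cases "\<V> = \<V>'")
        case True
        then show ?thesis using V \<open>G \<noteq> G'\<close> components_nonoverlap by (metis disjnt_def)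
      next
        case False
        then have "gap \<V> \<inter> gap \<V>' = {}" using gap_disj V by blast
        then show ?thesis using V(6,7) in_components_subset unfolding disjnt_def by blast
      qed
    qed
  next
    show "M \<subseteq> (\<Union>k\<in>{1..n}. \<Union>(\<G> k))"
    proof
      fix x assume x: "x \<in> M"
      define \<V> where "\<V> = {W \<in> \<W>. x \<in> W}"
      have V: "finite \<V>" "card \<V> \<le> n" "\<V> \<subseteq> \<W>" using mult [OF x] by (auto simp: \<V>_def)
      have "\<V> \<noteq> {}" using x cover by (auto simp: \<V>_def)
      \<comment> \<open>The gap at \<open>x\<close> runs from 0, the value for elements not
        containing \<open>x\<close>, to this positive minimum.\<close>
      define b where "b = Min ((\<lambda>W. d W x) ` \<V>)"
      have "b \<in> (\<lambda>W. d W x) ` \<V>" unfolding b_def using V(1) \<open>\<V> \<noteq> {}\<close> by (intro Min_in) auto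
      then have "0 < b" using dW x by (auto simp: \<V>_def)
      moreover have "b \<le> d W x" if "W \<in> \<V>" for W unfolding b_def using V(1) that by simp
      moreover have "d W x \<le> 0" if "W \<in> \<W> - \<V>" for W using dW [of W x] x that by (auto simp: \<V>_def)
      ultimately have "x \<in> gap \<V>" unfolding gap_def using x by blast
      then obtain G where G: "G \<in> components (gap \<V>)" "x \<in> G" by (metis UnionE Union_components)
      then have "G \<in> \<G> (card \<V>)" unfolding \<G>_def using V by blast
      moreover have "card \<V> \<in> {1..n}" using V \<open>\<V> \<noteq> {}\<close> by (simp add: Suc_le_eq card_gt_0_iff)
      ultimately show "x \<in> (\<Union>k\<in>{1..n}. \<Union>(\<G> k))" using G(2) by blast
    qed
  next
    fix k G assume "G \<in> \<G> k"
    then obtain \<V> where V: "\<V> \<subseteq> \<W>" "finite \<V>" "card \<V> = k" "G \<in> components (gap \<V>)"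
      unfolding \<G>_def by blast
    have G: "G \<noteq> {}" "connected G" "G \<subseteq> \<Inter>\<V>"
      using V(4) in_components_nonempty in_components_connected in_components_subset gap_sub [OF V(1)] by blast+
    then obtain C where "C \<in> components (\<Inter>\<V>)" "G \<subseteq> C"
      using exists_component_superset [of G "\<Inter>\<V>"] by blast
    then show "\<exists>\<V> C. \<V> \<subseteq> \<W> \<and> finite \<V> \<and> card \<V> = k \<and> C \<in> components (\<Inter>\<V>) \<and> G \<subseteq> C"
      using V G by blast
  qed
qed

section \<open>Colours, dimension count and the contradiction\<close>

theorem theorem3p1:
  fixes s t :: nat
    and V :: "'a::euclidean_space set"
    and M :: "((real ^ 'n) \<times> 'a) set"
    and \<U> :: "((real ^ 'n) \<times> 'a) set set"
  assumes "CARD('n) = s + 1"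
    and "subspace V" and "dim V = t"
    and "M = std_simplex \<times> V"
    and "\<And>U. U \<in> \<U> \<Longrightarrow> openin (top_of_set M) U"
    and "\<Union>\<U> = M"
    and "\<And>U C. U \<in> \<U> \<Longrightarrow> C \<in> components U \<Longrightarrow> \<exists>j. C \<inter> (opp_face j \<times> V) = {}"
    and "\<exists>R>0. \<forall>k \<V> C. 0 < k \<longrightarrow> k \<le> s + t \<longrightarrow> \<V> \<subseteq> \<U> \<longrightarrow> finite \<V> \<longrightarrow> card \<V> = k \<longrightarrow>
           C \<in> components (\<Inter>\<V>) \<longrightarrow> almost_affine V R (s + t - k) (snd ` C)"
  shows "\<exists>x\<in>M. \<exists>\<V>\<subseteq>\<U>. finite \<V> \<and> card \<V> \<ge> s + t + 1 \<and> (\<forall>U\<in>\<V>. x \<in> U)"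
proof (rule ccontr)
  assume neg: "\<not> ?thesis"
  define n where "n = s + t"
  have mult: "finite {U \<in> \<U>. x \<in> U} \<and> card {U \<in> \<U>. x \<in> U} \<le> n" if x: "x \<in> M" for x
  proof (rule ccontr)
    assume *: "\<not> ?thesis"
    \<comment> \<open>The negated goal concerns finite subfamilies, so one of size
      \<open>n + 1\<close> is extracted also when infinitely many elements contain
      \<open>x\<close>.\<close>
    have "\<exists>\<V>\<subseteq>{U \<in> \<U>. x \<in> U}. finite \<V> \<and> card \<V> = n + 1"
    proof (cases "finite {U \<in> \<U>. x \<in> U}")
      case True
      then have "n + 1 \<le> card {U \<in> \<U>. x \<in> U}" using * by simp
      then show ?thesis by (meson obtain_subset_with_card_n)
    next
      case False
      then show ?thesis by (meson infinite_arbitrarily_large)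
    qed
    then obtain \<V> where "\<V> \<subseteq> {U \<in> \<U>. x \<in> U}" "finite \<V>" "card \<V> = n + 1" by blast
    then have "\<V> \<subseteq> \<U> \<and> finite \<V> \<and> card \<V> \<ge> s + t + 1 \<and> (\<forall>U\<in>\<V>. x \<in> U)" by (auto simp: n_def)
    then show False using neg x by blast
  qed
  have "convex M"
    unfolding assms(4) using assms(2) convex_std_simplex by (intro convex_Times) (auto simp: subspace_imp_convex)
  then have lc: "locally connected M" by (rule convex_imp_locally_connected)
  obtain \<G> :: "nat \<Rightarrow> ((real ^ 'n) \<times> 'a) set set"
    where op: "\<forall>k. \<forall>G\<in>\<G> k. openin (top_of_set M) G" and disj: "\<forall>k. pairwise disjnt (\<G> k)"
    and cover: "M \<subseteq> (\<Union>k\<in>{1..n}. \<Union>(\<G> k))"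
    and comp: "\<forall>k. \<forall>G\<in>\<G> k. \<exists>\<V> C. \<V> \<subseteq> \<U> \<and> finite \<V> \<and> card \<V> = k \<and> C \<in> components (\<Inter>\<V>) \<and> G \<subseteq> C"
    using disjoint_open_families [OF lc assms(5) _ mult] assms(6) by auto
  obtain R where R: "\<And>k \<V> C. 0 < k \<Longrightarrow> k \<le> n \<Longrightarrow> \<V> \<subseteq> \<U> \<Longrightarrow> finite \<V> \<Longrightarrow> card \<V> = k \<Longrightarrow>
           C \<in> components (\<Inter>\<V>) \<Longrightarrow> almost_affine V R (n - k) (snd ` C)"
    using assms(8) unfolding n_def by blast
  have aff: "\<exists>A. affine A \<and> A \<subseteq> V \<and> aff_dim A = int i \<and> snd ` G \<subseteq> (\<Union>a\<in>A. ball a R)"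
    if i: "i < dim V" and G: "G \<in> \<G> (n - i)" for i G
  proof -
    \<comment> \<open>Multiplicity \<open>n - i\<close> corresponds to dimension \<open>i\<close>;
      since \<open>i < dim V\<close>, the degenerate disjunct of \<open>almost_affine\<close> is
      excluded.\<close>
    have k: "0 < n - i" "n - (n - i) = i" using i assms(3) by (auto simp: n_def)
    obtain \<V> C where "\<V> \<subseteq> \<U>" "finite \<V>" "card \<V> = n - i" "C \<in> components (\<Inter>\<V>)" "G \<subseteq> C"
      using comp [rule_format, OF G] by blast
    moreover from this have "almost_affine V R i (snd ` C)" using R [of "n - i" \<V> C] k by simp
    ultimately show ?thesis using i unfolding almost_affine_def by (meson image_mono linorder_not_le order_trans)
  qed
  define col where "col G = (SOME j. G \<inter> (opp_face j \<times> V) = {})" for G :: "((real ^ 'n) \<times> 'a) set"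
  \<comment> \<open>For \<open>k \<ge> 1\<close> the set \<V> has an element \<open>U\<close>, and
    \<open>C\<close> lies in one component of \<open>U\<close>, to which condition (i)
    applies.\<close>
  have col: "G \<inter> (opp_face (col G) \<times> V) = {}" if k: "1 \<le> k" and G: "G \<in> \<G> k" for k G
  proof -
    obtain \<V> C where V: "\<V> \<subseteq> \<U>" "finite \<V>" "card \<V> = k" "C \<in> components (\<Inter>\<V>)" "G \<subseteq> C"
      using comp [rule_format, OF G] by blast
    then obtain U where U: "U \<in> \<V>" using k by fastforce
    have "C \<subseteq> U" "C \<noteq> {}" "connected C"
      using V(4) U in_components_nonempty in_components_connected in_components_subset by blast+
    then obtain D where D: "D \<in> components U" "C \<subseteq> D" using exists_component_superset [of C U] by blast
    then obtain j where "D \<inter> (opp_face j \<times> V) = {}" using assms(7) U V(1) by blast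
    then have "G \<inter> (opp_face j \<times> V) = {}" using D(2) V(5) by blast
    then show ?thesis unfolding col_def by (rule someI)
  qed
  define P where "P j = \<Union>{G. col G = j \<and> (\<exists>k\<in>{1..n}. G \<in> \<G> k)}" for j
  have P: "\<exists>k G. k \<in> {1..n} \<and> G \<in> \<G> k \<and> col G = j \<and> x \<in> G" if x: "x \<in> P j" for x j
  proof -
    obtain G k where "x \<in> G" "col G = j" "k \<in> {1..n}" "G \<in> \<G> k"
      using x unfolding P_def by (elim UnionE CollectE conjE bexE)
    then show ?thesis by (intro exI conjI)
  qed
  \<comment> \<open>The range \<open>i < t\<close> means multiplicity \<open>n - i > s\<close>. For
    \<open>t = 0\<close> the set is empty.\<close>
  define H where "H = (\<Union>i<t. \<Union>(\<G> (n - i)))"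
  \<comment> \<open>Members of one disjoint family that share \<open>x\<close> coincide and have one
    colour, so the \<open>s + 1\<close> colours need \<open>s + 1\<close> different multiplicities;
    these do not fit into \<open>{1..s}\<close>.\<close>
  have PH: "(\<Inter>j. P j) \<subseteq> H"
  proof
    fix x assume x: "x \<in> (\<Inter>j. P j)"
    then have "\<exists>k G. k \<in> {1..n} \<and> G \<in> \<G> k \<and> col G = j \<and> x \<in> G" for j
      using x P [of x j] by simp
    then obtain \<kappa> \<Gamma> where \<kappa>: "\<And>j. \<kappa> j \<in> {1..n} \<and> \<Gamma> j \<in> \<G> (\<kappa> j) \<and> col (\<Gamma> j) = j \<and> x \<in> \<Gamma> j"
      by metis
    have "inj \<kappa>"
    proof (rule injI)
      fix i j assume "\<kappa> i = \<kappa> j"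
      then have "\<Gamma> i \<in> \<G> (\<kappa> j)" "\<Gamma> j \<in> \<G> (\<kappa> j)" "x \<in> \<Gamma> i" "x \<in> \<Gamma> j" using \<kappa> by metis+
      then have "\<Gamma> i = \<Gamma> j" using disj unfolding pairwise_def disjnt_def by blast
      then show "i = j" using \<kappa> by metis
    qed
    then have "card (range \<kappa>) = s + 1" using assms(1) by (simp add: card_image)
    then have "\<not> range \<kappa> \<subseteq> {1..s}" using card_mono [of "{1..s}" "range \<kappa>"] by auto
    then obtain j where "\<kappa> j \<notin> {1..s}" by blast
    then have "n - \<kappa> j < t" "n - (n - \<kappa> j) = \<kappa> j" using \<kappa> [of j] by (auto simp: n_def)
    then show "x \<in> H" unfolding H_def using \<kappa> [of j] by (metis UN_I UnionI lessThan_iff)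
  qed
  have "snd ` M \<subseteq> V" by (auto simp: assms(4))
  then have "\<exists>e K. continuous_on H e \<and> (\<forall>x\<in>H. norm (e x) \<le> K) \<and> (\<forall>x\<in>H. e x \<in> V) \<and>
      lowdim V t ((\<lambda>x. snd x + e x) ` H)"
    unfolding H_def
    using op disj aff assms(2,3) by (intro displacement_exists [where M = M and R = R]) auto
  then obtain e K where e: "continuous_on H e" "\<forall>x\<in>H. norm (e x) \<le> K" "\<forall>x\<in>H. e x \<in> V"
      "lowdim V (dim V) ((\<lambda>x. snd x + e x) ` H)"
    unfolding assms(3) by blast
  obtain v where v: "v \<in> V" "v \<notin> (\<lambda>x. snd x + e x) ` H"
    using not_lowdim_subspace [OF assms(2) e(4)] by blast
  \<comment> \<open>By \<open>PH\<close> the displacement is available on the whole intersection, so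
    the omitted value \<open>v\<close> would be attained on \<open>H\<close>.\<close>
  obtain x where "x \<in> (\<Inter>j. P j)" "snd x + e x = v"
  proof (rule simplex_cover_surj [OF assms(2,4), of P e K v])
    show "openin (top_of_set M) (P j)" for j
      unfolding P_def using op by (intro openin_Union) blast
    show "M \<subseteq> (\<Union>j. P j)"
      using cover unfolding P_def by blast
    show "P j \<inter> (opp_face j \<times> V) = {}" for j
      unfolding P_def using col by fastforce
    show "continuous_on (\<Inter>j. P j) e" using e(1) PH by (rule continuous_on_subset)
    show "norm (e x) \<le> K" if "x \<in> (\<Inter>j. P j)" for x using e(2) PH that by blast
    show "e x \<in> V" if "x \<in> (\<Inter>j. P j)" for x using e(3) PH that by blast
  qed (use v in auto)
  then show False using v(2) PH by blast
qed

end
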